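(* Let $m,n\ge 1$, $\sigma>0$ and $L>0$. For $j=1,\dots,m$ let $F_j=f_j+g_j:\mathbb{R}^n\to\mathbb{R}$, where $f_j:\mathbb{R}^n\to\mathbb{R}$ is twice continuously differentiable and $\sigma$-strongly convex, $\nabla f_j$ is Lipschitz continuous on $\mathbb{R}^n$ with Lipschitz constant $L$, and $g_j:\mathbb{R}^n\to\mathbb{R}$ is convex and continuous (not necessarily differentiable). Let $F=(F_1,\dots,F_m)$, let $x^0\in\mathbb{R}^n$ and $r,\beta\in(0,1)$, and suppose that the level set $M:=\{x\in\mathbb{R}^n : F(x)\le F(x^0)\}$ is bounded. Let $\{x^k\}_{k\ge 0}$ be the infinite sequence generated from $x^0$ by the Newton-type proximal gradient method (described in the context) with parameters $r,\beta$. Then every accumulation point of $\{x^k\}$ is a critical point of the multi-objective problem $\min_{x\in\mathbb{R}^n} F(x)$.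
   Context: Inequalities in $\mathbb{R}^m$ are understood componentwise. Strong convexity: $f:\mathbb{R}^n\to\mathbb{R}$ is $\sigma$-strongly convex if $f(\alpha x+(1-\alpha)y)\le \alpha f(x)+(1-\alpha)f(y)-\frac12\sigma\alpha(1-\alpha)\|x-y\|^2$ for all $x,y\in\mathbb{R}^n$ and $\alpha\in[0,1]$. Critical point: $x^*\in\mathbb{R}^n$ is a critical point of the problem $\min_{x\in\mathbb{R}^n}F(x)$ if $\max_{1\le j\le m}F_j'(x^*;d)\ge 0$ for all $d\in\mathbb{R}^n$, where $F_j'(x^*;d)=\lim_{\alpha\to0^+}\frac{F_j(x^*+\alpha d)-F_j(x^* )}{\alpha}$ is the directional derivative. Subproblem: for $x,d\in\mathbb{R}^n$ put $Q_j(x,d)=\nabla f_j(x)^Td+\frac12 d^T\nabla^2 f_j(x)d+g_j(x+d)-g_j(x)$ and $Q(x,d)=\max_{1\le j\le m}Q_j(x,d)$. Let $d(x)$ be the minimizer over $d\in\mathbb{R}^n$ of $Q(x,d)$ (it exists and is unique when every $f_j$ is $\sigma$-strongly convex), and let $t(x)=Q(x,d(x))$. Newton-type proximal gradient method: given $x^0\in\mathbb{R}^n$ and $r,\beta\in(0,1)$, for $k=0,1,2,\dots$: compute $d^k=d(x^k)$ and $t^k=t(x^k)$; let $\alpha_k$ be the first element $\alpha$ of the list $1,r,r^2,\dots$ such that $F_j(x^k+\alpha d^k)\le F_j(x^k)+\beta\alpha t^k$ for every $j=1,\dots,m$; set $x^{k+1}=x^k+\alpha_k d^k$. *)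

theory Defs
  imports "HOL-Analysis.Analysis"
begin

definition gradient :: "(real^'n \<Rightarrow> real) \<Rightarrow> real^'n \<Rightarrow> real^'n" where
  "gradient f x = (THE D. GDERIV f x :> D)"

definition hessian :: "(real^'n \<Rightarrow> real) \<Rightarrow> real^'n \<Rightarrow> real^'n^'n" where
  "hessian f x = jacobian (gradient f) (at x)"

definition twice_continuously_differentiable :: "(real^'n \<Rightarrow> real) \<Rightarrow> bool" where
  "twice_continuously_differentiable f \<longleftrightarrow>
     (\<forall>x. f differentiable (at x)) \<and>
     (\<forall>x. gradient f differentiable (at x)) \<and>
     continuous_on UNIV (hessian f)"

definition strongly_convex :: "real \<Rightarrow> (real^'n \<Rightarrow> real) \<Rightarrow> bool" where
  "strongly_convex \<sigma> f \<longleftrightarrow>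
     (\<forall>x y. \<forall>\<alpha>\<in>{0..1}.
        f (\<alpha> *\<^sub>R x + (1 - \<alpha>) *\<^sub>R y)
          \<le> \<alpha> * f x + (1 - \<alpha>) * f y - 1/2 * \<sigma> * \<alpha> * (1 - \<alpha>) * (norm (x - y))\<^sup>2)"

(* Used only where the limit exists; Lim is unspecified otherwise. *)
definition dir_deriv :: "(real^'n \<Rightarrow> real) \<Rightarrow> real^'n \<Rightarrow> real^'n \<Rightarrow> real" where
  "dir_deriv h x d = Lim (at_right 0) (\<lambda>\<alpha>. (h (x + \<alpha> *\<^sub>R d) - h x) / \<alpha>)"

definition critical_point :: "(real^'n \<Rightarrow> real^'m) \<Rightarrow> real^'n \<Rightarrow> bool" where
  "critical_point F x \<longleftrightarrow> (\<forall>d. (MAX j. dir_deriv (\<lambda>y. F y $ j) x d) \<ge> 0)"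

definition objective ::
  "('m \<Rightarrow> real^'n \<Rightarrow> real) \<Rightarrow> ('m \<Rightarrow> real^'n \<Rightarrow> real) \<Rightarrow> real^'n \<Rightarrow> real^'m" where
  "objective f g x = (\<chi> j. f j x + g j x)"

definition newton_model_component ::
  "(real^'n \<Rightarrow> real) \<Rightarrow> (real^'n \<Rightarrow> real) \<Rightarrow> real^'n \<Rightarrow> real^'n \<Rightarrow> real" where
  "newton_model_component f g x d =
     gradient f x \<bullet> d + 1/2 * (d \<bullet> (hessian f x *v d)) + g (x + d) - g x"

definition newton_model ::
  "('m::finite \<Rightarrow> real^'n \<Rightarrow> real) \<Rightarrow> ('m \<Rightarrow> real^'n \<Rightarrow> real) \<Rightarrow> real^'n \<Rightarrow> real^'n \<Rightarrow> real" where
  "newton_model f g x d = (MAX j. newton_model_component (f j) (g j) x d)"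

(* For strongly convex C^2 functions f j and convex g j, the model is strongly convex and
   continuous in d, so its minimizer exists and is unique; otherwise the value is arbitrary. *)
definition newton_direction ::
  "('m::finite \<Rightarrow> real^'n \<Rightarrow> real) \<Rightarrow> ('m \<Rightarrow> real^'n \<Rightarrow> real) \<Rightarrow> real^'n \<Rightarrow> real^'n" where
  "newton_direction f g x = (ARG_MIN (newton_model f g x) d. True)"

definition newton_value ::
  "('m::finite \<Rightarrow> real^'n \<Rightarrow> real) \<Rightarrow> ('m \<Rightarrow> real^'n \<Rightarrow> real) \<Rightarrow> real^'n \<Rightarrow> real" where
  "newton_value f g x = newton_model f g x (newton_direction f g x)"

definition sufficient_decrease ::
  "('m::finite \<Rightarrow> real^'n \<Rightarrow> real) \<Rightarrow> ('m \<Rightarrow> real^'n \<Rightarrow> real) \<Rightarrow> real \<Rightarrow> real^'n \<Rightarrow> real \<Rightarrow> bool" where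
  "sufficient_decrease f g \<beta> x \<alpha> \<longleftrightarrow>
     (\<forall>j. objective f g (x + \<alpha> *\<^sub>R newton_direction f g x) $ j
            \<le> objective f g x $ j + \<beta> * \<alpha> * newton_value f g x)"

(* First entry of the list 1, r, r^2, ... that passes the test. *)
definition step_size ::
  "('m::finite \<Rightarrow> real^'n \<Rightarrow> real) \<Rightarrow> ('m \<Rightarrow> real^'n \<Rightarrow> real) \<Rightarrow> real \<Rightarrow> real \<Rightarrow> real^'n \<Rightarrow> real" where
  "step_size f g r \<beta> x = r ^ (LEAST i. sufficient_decrease f g \<beta> x (r ^ i))"

primrec newton_prox_grad ::
  "('m::finite \<Rightarrow> real^'n \<Rightarrow> real) \<Rightarrow> ('m \<Rightarrow> real^'n \<Rightarrow> real) \<Rightarrow> real \<Rightarrow> real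
     \<Rightarrow> real^'n \<Rightarrow> nat \<Rightarrow> real^'n" where
  "newton_prox_grad f g r \<beta> x0 0 = x0"
| "newton_prox_grad f g r \<beta> x0 (Suc k) =
     (let x = newton_prox_grad f g r \<beta> x0 k
      in x + step_size f g r \<beta> x *\<^sub>R newton_direction f g x)"

end

theory Submission
  imports Defs
begin

text \<open>
  Write \<open>Q x\<close> for the Newton model at \<open>x\<close> and \<open>t x\<close> for its minimal value. Since \<open>Q x 0 = 0\<close>, always
  \<open>t x \<le> 0\<close>. The proof shows that \<open>t\<close> tends to \<open>0\<close> along the convergent subsequence, so that
  \<open>Q xstar \<ge> 0\<close>, and reads off criticality from the behaviour of \<open>Q xstar\<close> near \<open>0\<close>.

  The line search accepts every step \<open>a \<le> min 1 (\<sigma> / L)\<close>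
  (\<open>sufficient_decrease_small_step\<close>): the smooth part exceeds its linearization by at
  most \<open>L / 2 * a\<^sup>2 * (norm d)\<^sup>2\<close>, while strong convexity puts at least
  \<open>\<sigma> / 2 * (norm d)\<^sup>2\<close> into the quadratic term of the model. Hence step sizes never fall below
  \<open>min 1 (r * \<sigma> / L)\<close> (\<open>step_size_acceptance\<close>), and each iteration lowers every objective by at
  least a fixed multiple of \<open>- t\<close>.

  Objective values are nonincreasing along the iterates and converge along the subsequence, so the
  decrease between consecutive members of the subsequence tends to \<open>0\<close>; it dominates the decrease
  of a single iteration, so \<open>t\<close> tends to \<open>0\<close> there. For a fixed direction \<open>d\<close> the inequality
  \<open>t x \<le> Q x d\<close> (\<open>newton_value_le_newton_model\<close>, which rests on coercivity of the model) and
  continuity of \<open>Q x d\<close> in \<open>x\<close> (\<open>tendsto_newton_model_in_point\<close>) give \<open>Q xstar d \<ge> 0\<close>.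

  Finally \<open>Q xstar (a *\<^sub>R d) / a\<close> tends to the maximum of the directional derivatives as \<open>a\<close>
  decreases to \<open>0\<close> (\<open>critical_point_if_newton_model_nonneg\<close>), which is therefore nonnegative.
\<close>

section \<open>Limits of maxima and one-sided derivatives of convex functions\<close>

lemma tendsto_Max_image:
  fixes h :: "'i \<Rightarrow> 'a \<Rightarrow> 'b::linorder_topology"
  assumes "finite I" "I \<noteq> {}" "\<And>i. i \<in> I \<Longrightarrow> (h i \<longlongrightarrow> l i) F"
  shows "((\<lambda>a. MAX i\<in>I. h i a) \<longlongrightarrow> (MAX i\<in>I. l i)) F"
  using assms
proof (induction I rule: finite_ne_induct)
  case (singleton i)
  then show ?case by simp
next
  case (insert i I)
  then have "((\<lambda>a. max (h i a) (MAX i\<in>I. h i a)) \<longlongrightarrow> max (l i) (MAX i\<in>I. l i)) F"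
    by (intro tendsto_max) auto
  then show ?case using insert by simp
qed

text \<open>
  The one-sided directional derivative exists because the quotient is nondecreasing in the step
  \<open>a > 0\<close> and, by convexity on the segment from \<open>x - d\<close> to \<open>x + a *\<^sub>R d\<close>, bounded below by the
  backward difference \<open>g x - g (x - d)\<close>; the limit is its infimum.
\<close>

lemma convex_difference_quotient_tendsto:
  fixes g :: "'a::real_vector \<Rightarrow> real"
  assumes "convex_on UNIV g"
  obtains l where "((\<lambda>a. (g (x + a *\<^sub>R d) - g x) / a) \<longlongrightarrow> l) (at_right 0)"
proof -
  define q where "q a = (g (x + a *\<^sub>R d) - g x) / a" for a
  have mono: "q a \<le> q b" if "0 < a" "a \<le> b" for a b
  proof -
    have "x + a *\<^sub>R d = (1 - a / b) *\<^sub>R x + (a / b) *\<^sub>R (x + b *\<^sub>R d)"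
      using that by (simp add: algebra_simps)
    then have "g (x + a *\<^sub>R d) \<le> (1 - a / b) * g x + (a / b) * g (x + b *\<^sub>R d)"
      using convex_onD[OF assms, of "a / b" x "x + b *\<^sub>R d"] that by simp
    then have "g (x + a *\<^sub>R d) - g x \<le> a * q b"
      using that by (simp add: q_def field_simps)
    then show ?thesis
      using that by (simp add: q_def[of a] divide_le_eq mult.commute)
  qed
  have below: "g x - g (x - d) \<le> q a" if "0 < a" for a
  proof -
    have "(1 - a / (1 + a)) *\<^sub>R (x + a *\<^sub>R d) + (a / (1 + a)) *\<^sub>R (x - d)
        = x + ((1 - a / (1 + a)) * a - a / (1 + a)) *\<^sub>R d"
      by (simp add: algebra_simps)
    also have "(1 - a / (1 + a)) * a - a / (1 + a) = 0"
      using that by (simp add: field_simps)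
    finally have "g x \<le> (1 - a / (1 + a)) * g (x + a *\<^sub>R d) + (a / (1 + a)) * g (x - d)"
      using convex_onD[OF assms, of "a / (1 + a)" "x + a *\<^sub>R d" "x - d"] that by simp
    moreover have "1 - a / (1 + a) = 1 / (1 + a)"
      using that by (simp add: field_simps)
    ultimately have "g x \<le> 1 / (1 + a) * g (x + a *\<^sub>R d) + (a / (1 + a)) * g (x - d)"
      by simp
    also have "\<dots> = (g (x + a *\<^sub>R d) + a * g (x - d)) / (1 + a)"
      by (simp add: add_divide_distrib)
    finally have "(1 + a) * g x \<le> g (x + a *\<^sub>R d) + a * g (x - d)"
      using that by (simp add: field_simps)
    then show ?thesis
      using that by (simp add: q_def field_simps)
  qed
  have bdd: "bdd_below (q ` {0<..})"
    using below by (intro bdd_belowI2[where m = "g x - g (x - d)"]) auto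
  define l where "l = Inf (q ` {0<..})"
  have "(q \<longlongrightarrow> l) (at_right 0)"
  proof (rule order_tendstoI)
    fix c assume "c < l"
    have "l \<le> q a" if "0 < a" for a
      unfolding l_def using bdd that by (intro cInf_lower) auto
    then show "\<forall>\<^sub>F a in at_right 0. c < q a"
      using \<open>c < l\<close> by (intro eventually_at_rightI[of 0 1]) (auto intro: less_le_trans)
  next
    fix c assume "l < c"
    then obtain b where "0 < b" "q b < c"
      using cInf_lessD[of "q ` {0<..}" c] by (auto simp: l_def)
    then show "\<forall>\<^sub>F a in at_right 0. q a < c"
      using mono by (intro eventually_at_rightI[of 0 b]) (auto intro: le_less_trans[of _ "q b"])
  qed
  then show ?thesis
    using that by (simp add: q_def[abs_def])
qed

section \<open>Gradient and Hessian of a strongly convex function\<close>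

text \<open>
  The derivative is a linear functional, so its adjoint at \<open>1\<close> is a gradient vector; uniqueness of
  the derivative makes the definite description pick it.
\<close>

lemma differentiable_imp_GDERIV_gradient:
  fixes f :: "real^'n \<Rightarrow> real"
  assumes "f differentiable (at x)"
  shows "GDERIV f x :> gradient f x"
proof -
  obtain f' where f': "(f has_derivative f') (at x)"
    using assms by (auto simp: differentiable_def)
  have "f' = (\<lambda>h. h \<bullet> adjoint f' 1)"
    using adjoint_works[OF has_derivative_linear[OF f'], of _ 1] by simp
  then have D: "GDERIV f x :> adjoint f' 1"
    using f' by (simp add: gderiv_def)
  moreover have "D' = adjoint f' 1" if "GDERIV f x :> D'" for D'
    using has_derivative_unique[of f "\<lambda>h. h \<bullet> D'" x "\<lambda>h. h \<bullet> adjoint f' 1"] that D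
    by (metis gderiv_def vector_eq_ldot)
  ultimately show ?thesis
    unfolding gradient_def by (rule theI)
qed

lemma GDERIV_along_line:
  assumes "GDERIV f (x + a *\<^sub>R d) :> D"
  shows "((\<lambda>a. f (x + a *\<^sub>R d)) has_real_derivative D \<bullet> d) (at a)"
proof -
  have "((\<lambda>a. f (x + a *\<^sub>R d)) has_derivative (\<lambda>h. (h *\<^sub>R d) \<bullet> D)) (at a)"
    using assms unfolding gderiv_def
    by (rule has_derivative_compose[rotated]) (auto intro!: derivative_eq_intros)
  then show ?thesis
    by (simp add: has_field_derivative_def inner_commute mult_commute_abs)
qed

lemma difference_quotient_tendsto_gradient:
  fixes f :: "real^'n \<Rightarrow> real"
  assumes "f differentiable (at x)"
  shows "((\<lambda>a. (f (x + a *\<^sub>R d) - f x) / a) \<longlongrightarrow> gradient f x \<bullet> d) (at_right 0)"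
proof -
  have "((\<lambda>a. f (x + a *\<^sub>R d)) has_real_derivative gradient f x \<bullet> d) (at 0)"
    using differentiable_imp_GDERIV_gradient[OF assms] by (intro GDERIV_along_line) simp
  then show ?thesis
    by (auto simp: DERIV_def intro: tendsto_within_subset)
qed

text \<open>
  Strong convexity bounds the difference quotient over the segment from \<open>x\<close> to \<open>x + d\<close>; this is
  its limit as the step tends to \<open>0\<close>.
\<close>

lemma strongly_convex_gradient_inequality:
  fixes f :: "real^'n \<Rightarrow> real"
  assumes "strongly_convex \<sigma> f" "f differentiable (at x)"
  shows "gradient f x \<bullet> d + \<sigma> / 2 * (norm d)\<^sup>2 \<le> f (x + d) - f x"
proof -
  have "(f (x + a *\<^sub>R d) - f x) / a \<le> f (x + d) - f x - 1/2 * \<sigma> * (1 - a) * (norm d)\<^sup>2"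
    if "0 < a" "a < 1" for a
  proof -
    have "a *\<^sub>R (x + d) + (1 - a) *\<^sub>R x = x + a *\<^sub>R d"
      by (simp add: algebra_simps)
    then have "f (x + a *\<^sub>R d)
        \<le> a * f (x + d) + (1 - a) * f x - 1/2 * \<sigma> * a * (1 - a) * (norm d)\<^sup>2"
      using assms(1) that unfolding strongly_convex_def
      by (metis (no_types) add_diff_cancel_left' atLeastAtMost_iff less_imp_le)
    then show ?thesis
      using that by (simp add: field_simps)
  qed
  then have "\<forall>\<^sub>F a in at_right 0. (f (x + a *\<^sub>R d) - f x) / a
      \<le> f (x + d) - f x - 1/2 * \<sigma> * (1 - a) * (norm d)\<^sup>2"
    by (intro eventually_at_rightI[of 0 1]) auto
  moreover have "((\<lambda>a. f (x + d) - f x - 1/2 * \<sigma> * (1 - a) * (norm d)\<^sup>2)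
      \<longlongrightarrow> f (x + d) - f x - 1/2 * \<sigma> * (1 - 0) * (norm d)\<^sup>2) (at_right 0)"
    by (intro tendsto_intros)
  ultimately have "gradient f x \<bullet> d \<le> f (x + d) - f x - 1/2 * \<sigma> * (1 - 0) * (norm d)\<^sup>2"
    using difference_quotient_tendsto_gradient[OF assms(2)]
    by (intro tendsto_le[OF trivial_limit_at_right_real]) auto
  then show ?thesis by simp
qed

text \<open>
  Adding the gradient inequality at the two ends of a segment shows that the gradient is strongly
  monotone; differentiating this along \<open>d\<close> gives the bound for the Hessian.
\<close>

lemma strongly_convex_hessian_lower_bound:
  fixes f :: "real^'n \<Rightarrow> real"
  assumes "strongly_convex \<sigma> f" "\<And>y. f differentiable (at y)"
    and "gradient f differentiable (at x)"
  shows "\<sigma> * (norm d)\<^sup>2 \<le> d \<bullet> (hessian f x *v d)"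
proof -
  have monotone: "\<sigma> * (norm e)\<^sup>2 \<le> (gradient f (x + e) - gradient f x) \<bullet> e" for e
    using strongly_convex_gradient_inequality[OF assms(1,2), of x e]
      strongly_convex_gradient_inequality[OF assms(1,2), of "x + e" "- e"]
    by (simp add: inner_diff_left)
  have "(gradient f has_derivative (\<lambda>h. hessian f x *v h)) (at (x + 0 *\<^sub>R d))"
    using assms(3) by (simp add: hessian_def jacobian_works)
  then have "((\<lambda>a. gradient f (x + a *\<^sub>R d)) has_derivative (\<lambda>a. hessian f x *v (a *\<^sub>R d))) (at 0)"
    by (rule has_derivative_compose[rotated]) (auto intro!: derivative_eq_intros)
  then have "((\<lambda>a. gradient f (x + a *\<^sub>R d) \<bullet> d) has_derivative
      (\<lambda>a. (hessian f x *v (a *\<^sub>R d)) \<bullet> d)) (at 0)"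
    by (rule has_derivative_inner_left)
  then have "((\<lambda>a. gradient f (x + a *\<^sub>R d) \<bullet> d) has_real_derivative
      d \<bullet> (hessian f x *v d)) (at 0)"
    by (simp add: has_field_derivative_def matrix_vector_mult_scaleR inner_commute mult_commute_abs)
  then have "((\<lambda>a. (gradient f (x + a *\<^sub>R d) \<bullet> d - gradient f x \<bullet> d) / a)
      \<longlongrightarrow> d \<bullet> (hessian f x *v d)) (at_right 0)"
    by (auto simp: DERIV_def intro: tendsto_within_subset)
  moreover have "\<sigma> * (norm d)\<^sup>2 \<le> (gradient f (x + a *\<^sub>R d) \<bullet> d - gradient f x \<bullet> d) / a"
    if "0 < a" for a
  proof -
    have "a * (a * (\<sigma> * (norm d)\<^sup>2))
        \<le> a * (gradient f (x + a *\<^sub>R d) \<bullet> d - gradient f x \<bullet> d)"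
      using monotone[of "a *\<^sub>R d"]
      by (simp add: inner_diff_left right_diff_distrib power_mult_distrib power2_eq_square ac_simps)
    then show ?thesis
      using that by (simp add: pos_le_divide_eq mult.commute)
  qed
  then have "\<forall>\<^sub>F a in at_right 0. \<sigma> * (norm d)\<^sup>2
      \<le> (gradient f (x + a *\<^sub>R d) \<bullet> d - gradient f x \<bullet> d) / a"
    by (intro eventually_at_rightI[of 0 1]) auto
  ultimately show ?thesis
    by (intro tendsto_lowerbound[OF _ _ trivial_limit_at_right_real])
qed

text \<open>
  The left side minus the right side, as a function of \<open>a\<close>, has nonpositive derivative by
  Cauchy-Schwarz and the Lipschitz bound.
\<close>

lemma lipschitz_gradient_descent_inequality:
  fixes f :: "real^'n \<Rightarrow> real"
  assumes "L-lipschitz_on UNIV (gradient f)" "\<And>y. f differentiable (at y)" "0 \<le> a"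
  shows "f (x + a *\<^sub>R d) \<le> f x + a * (gradient f x \<bullet> d) + L / 2 * a\<^sup>2 * (norm d)\<^sup>2"
proof -
  define \<psi> where
    "\<psi> a = f (x + a *\<^sub>R d) - a * (gradient f x \<bullet> d) - L / 2 * a\<^sup>2 * (norm d)\<^sup>2" for a
  have "\<psi> a \<le> \<psi> 0"
  proof (rule DERIV_nonpos_imp_nonincreasing[OF assms(3)])
    fix b :: real assume "0 \<le> b" "b \<le> a"
    have "(\<psi> has_real_derivative
        gradient f (x + b *\<^sub>R d) \<bullet> d - gradient f x \<bullet> d - L * b * (norm d)\<^sup>2) (at b)"
      unfolding \<psi>_def[abs_def]
      using GDERIV_along_line[OF differentiable_imp_GDERIV_gradient[OF assms(2)], where x = x and a = b and d = d]
      by (auto intro!: derivative_eq_intros)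
    moreover have "gradient f (x + b *\<^sub>R d) \<bullet> d - gradient f x \<bullet> d \<le> L * b * (norm d)\<^sup>2"
    proof -
      have "(gradient f (x + b *\<^sub>R d) - gradient f x) \<bullet> d
          \<le> norm (gradient f (x + b *\<^sub>R d) - gradient f x) * norm d"
        by (rule norm_cauchy_schwarz)
      also have "\<dots> \<le> (L * norm (b *\<^sub>R d)) * norm d"
        using lipschitz_onD[OF assms(1), of "x + b *\<^sub>R d" x]
        by (intro mult_right_mono) (auto simp: dist_norm)
      finally show ?thesis
        using \<open>0 \<le> b\<close> by (simp add: inner_diff_left power2_eq_square)
    qed
    ultimately show "\<exists>y. (\<psi> has_real_derivative y) (at b) \<and> y \<le> 0"
      by (intro exI conjI) auto
  qed
  then show ?thesis by (simp add: \<psi>_def)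
qed

section \<open>The Newton model\<close>

lemma newton_model_component_zero [simp]: "newton_model_component f g x 0 = 0"
  by (simp add: newton_model_component_def)

lemma newton_model_zero [simp]: "newton_model f g x 0 = 0"
  by (simp add: newton_model_def)

lemma newton_model_component_le: "newton_model_component (f j) (g j) x d \<le> newton_model f g x d"
  unfolding newton_model_def by (rule Max_ge) auto

lemma continuous_on_newton_model:
  assumes "\<And>j. continuous_on UNIV (g j)"
  shows "continuous_on UNIV (newton_model f g x)"
proof -
  have "continuous_on UNIV (newton_model_component (f j) (g j) x)" for j
    unfolding newton_model_component_def[abs_def]
    by (intro continuous_intros matrix_vector_mult_linear_continuous_on
        continuous_on_compose2[OF assms]) auto
  then show ?thesis
    unfolding newton_model_def[abs_def] continuous_on_def
    by (intro ballI tendsto_Max_image) auto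
qed

text \<open>
  This is where the continuity of the Hessian is used. Continuity in the base point for each fixed
  direction suffices to pass to the limit in \<open>newton_value_le_newton_model\<close>.
\<close>

lemma tendsto_newton_model_in_point:
  assumes "\<And>j. twice_continuously_differentiable (f j)"
    and "\<And>j. continuous_on UNIV (g j)"
    and "(X \<longlongrightarrow> x) F"
  shows "((\<lambda>k. newton_model f g (X k) d) \<longlongrightarrow> newton_model f g x d) F"
  unfolding newton_model_def
proof (rule tendsto_Max_image)
  fix j
  have "isCont (gradient (f j)) x" "isCont (hessian (f j)) x" "isCont (g j) x" "isCont (g j) (x + d)"
    using assms(1)[of j] assms(2)[of j]
    by (auto simp: twice_continuously_differentiable_def continuous_on_eq_continuous_at
        differentiable_imp_continuous_within)
  note lims = this[THEN isCont_tendsto_compose]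
  have "((\<lambda>k. X k + d) \<longlongrightarrow> x + d) F"
    by (intro tendsto_intros assms(3))
  note lims' = lims(1-3)[OF assms(3)] lims(4)[OF this]
  have "((\<lambda>k. hessian (f j) (X k) *v d) \<longlongrightarrow> hessian (f j) x *v d) F"
    unfolding matrix_vector_mult_def by (intro tendsto_intros lims')
  then show "((\<lambda>k. newton_model_component (f j) (g j) (X k) d)
      \<longlongrightarrow> newton_model_component (f j) (g j) x d) F"
    unfolding newton_model_component_def by (intro tendsto_intros lims')
qed auto

text \<open>
  Strong convexity of the model in the direction, on segments starting at \<open>0\<close>, where the model
  vanishes; it drives the coercivity argument.
\<close>

lemma newton_model_component_growth:
  assumes "convex_on UNIV g" "\<And>d. \<sigma> * (norm d)\<^sup>2 \<le> d \<bullet> (hessian f x *v d)"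
    and "0 < a" "a \<le> 1"
  shows "newton_model_component f g x (a *\<^sub>R d)
    \<le> a * newton_model_component f g x d - \<sigma> / 2 * a * (1 - a) * (norm d)\<^sup>2"
proof -
  have "(1 - a) *\<^sub>R x + a *\<^sub>R (x + d) = x + a *\<^sub>R d"
    by (simp add: algebra_simps)
  then have "g (x + a *\<^sub>R d) \<le> (1 - a) * g x + a * g (x + d)"
    using convex_onD[OF assms(1), of a x "x + d"] assms(3,4) by simp
  moreover have "a * (1 - a) * (\<sigma> * (norm d)\<^sup>2) \<le> a * (1 - a) * (d \<bullet> (hessian f x *v d))"
    using assms by (intro mult_left_mono) auto
  ultimately show ?thesis
    by (simp add: newton_model_component_def matrix_vector_mult_scaleR field_simps)
qed

text \<open>
  On the unit sphere the model is bounded by some \<open>C\<close> by compactness. Scaling a long direction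
  \<open>d\<close> back to the sphere, strong convexity yields
  \<open>newton_model_component f g x d \<ge> norm d * (\<sigma> / 2 * (norm d - 1) - C)\<close> for
  \<open>norm d > 1\<close>, and this is positive once \<open>norm d > 1 + 2 * C / \<sigma>\<close>.
\<close>

lemma newton_model_component_coercive:
  fixes f g :: "real^'n \<Rightarrow> real"
  assumes "convex_on UNIV g" "continuous_on UNIV g"
    and "\<And>d. \<sigma> * (norm d)\<^sup>2 \<le> d \<bullet> (hessian f x *v d)" "\<sigma> > 0"
  obtains R where "\<And>d. R < norm d \<Longrightarrow> 0 < newton_model_component f g x d"
proof -
  let ?q = "newton_model_component f g x"
  have "continuous_on (sphere 0 1) ?q"
    unfolding newton_model_component_def[abs_def]
    by (intro continuous_intros matrix_vector_mult_linear_continuous_on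
        continuous_on_compose2[OF assms(2)]) auto
  then have "bounded (?q ` sphere 0 1)"
    by (intro compact_imp_bounded compact_continuous_image) auto
  then obtain C where C: "0 < C" "\<And>u. norm u = 1 \<Longrightarrow> \<bar>?q u\<bar> \<le> C"
    by (auto simp: bounded_pos)
  have "0 < ?q d" if "1 + 2 * C / \<sigma> < norm d" for d
  proof -
    have "0 \<le> 2 * C / \<sigma>" using C(1) assms(4) by simp
    then have d: "1 < norm d" using that by linarith
    then have "d \<noteq> 0" by (metis norm_zero not_one_less_zero)
    define u where "u = (1 / norm d) *\<^sub>R d"
    have "norm u = 1" using \<open>d \<noteq> 0\<close> by (simp add: u_def)
    have "- C \<le> ?q u"
      using C(2)[OF \<open>norm u = 1\<close>] by linarith
    also have "\<dots> \<le> 1 / norm d * ?q d - \<sigma> / 2 * (1 / norm d) * (1 - 1 / norm d) * (norm d)\<^sup>2"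
      unfolding u_def using d by (intro newton_model_component_growth assms) (auto simp: divide_le_eq)
    also have "\<sigma> / 2 * (1 / norm d) * (1 - 1 / norm d) * (norm d)\<^sup>2 = \<sigma> / 2 * (norm d - 1)"
      using \<open>d \<noteq> 0\<close> by (simp add: field_simps power2_eq_square)
    finally have "\<sigma> / 2 * (norm d - 1) - C \<le> 1 / norm d * ?q d" by simp
    moreover have "C < \<sigma> / 2 * (norm d - 1)"
      using that assms(4) by (simp add: field_simps)
    ultimately have "0 < 1 / norm d * ?q d" by linarith
    then show ?thesis using d by (simp add: zero_less_divide_iff)
  qed
  then show ?thesis using that by blast
qed

text \<open>
  Outside a large ball the model is positive, hence above its value at \<open>0\<close>, so a minimizer over the
  compact ball is a global one. Once some minimizer exists, the choice made in the definition of
  the Newton direction is a minimizer too.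
\<close>

lemma newton_value_le_newton_model:
  fixes f g :: "'m::finite \<Rightarrow> real^'n \<Rightarrow> real"
  assumes "\<And>j. convex_on UNIV (g j)" "\<And>j. continuous_on UNIV (g j)"
    and "\<And>j d. \<sigma> * (norm d)\<^sup>2 \<le> d \<bullet> (hessian (f j) x *v d)" "\<sigma> > 0"
  shows "newton_value f g x \<le> newton_model f g x d"
proof -
  \<comment> \<open>Coercivity of a single component is enough, since the model dominates each of them.\<close>
  fix j :: 'm
  obtain R where R: "\<And>d. R < norm d \<Longrightarrow> 0 < newton_model_component (f j) (g j) x d"
    by (rule newton_model_component_coercive[OF assms(1)[of j] assms(2)[of j] assms(3)[where j = j] assms(4)]) (rule that)
  have "continuous_on (cball 0 \<bar>R\<bar>) (newton_model f g x)"
    by (rule continuous_on_subset[OF continuous_on_newton_model[OF assms(2)] subset_UNIV])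
  then have "\<exists>e\<in>cball 0 \<bar>R\<bar>. \<forall>d\<in>cball 0 \<bar>R\<bar>. newton_model f g x e \<le> newton_model f g x d"
    by (intro continuous_attains_inf compact_cball) auto
  then obtain e where e: "\<forall>d\<in>cball 0 \<bar>R\<bar>. newton_model f g x e \<le> newton_model f g x d"
    by (elim bexE)
  have "newton_model f g x e \<le> newton_model f g x d" for d
  proof (cases "norm d \<le> \<bar>R\<bar>")
    case False
    then have "0 < newton_model f g x d"
      using R[of d] newton_model_component_le[of f j g x d] by linarith
    then show ?thesis using bspec[OF e, of 0] by simp
  qed (use bspec[OF e, of d] in simp)
  then have "is_arg_min (newton_model f g x) (\<lambda>_. True) e"
    by (simp add: is_arg_min_linorder)
  then have "is_arg_min (newton_model f g x) (\<lambda>_. True) (newton_direction f g x)"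
    unfolding newton_direction_def arg_min_def by (rule someI)
  then show ?thesis
    by (simp add: is_arg_min_linorder newton_value_def)
qed

section \<open>The line search\<close>

text \<open>
  The model value charges the smooth part with \<open>1/2 * (d \<bullet> (hessian (f j) x *v d))\<close>, which is at
  least \<open>\<sigma> / 2 * (norm d)\<^sup>2\<close>. For \<open>L * a \<le> \<sigma>\<close> this absorbs the quadratic error of the descent
  inequality, so the objectives drop by the full \<open>a * newton_value f g x\<close>; since that value is
  nonpositive, a fraction \<open>\<beta> \<le> 1\<close> of it is also attained.
\<close>

lemma sufficient_decrease_small_step:
  fixes f g :: "'m::finite \<Rightarrow> real^'n \<Rightarrow> real"
  assumes "\<And>j y. (f j) differentiable (at y)" "\<And>j. L-lipschitz_on UNIV (gradient (f j))"
    and "\<And>j. convex_on UNIV (g j)"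
    and "\<And>j d. \<sigma> * (norm d)\<^sup>2 \<le> d \<bullet> (hessian (f j) x *v d)"
    and "newton_value f g x \<le> 0" "\<beta> \<le> 1" "0 < a" "a \<le> 1" "L * a \<le> \<sigma>"
  shows "sufficient_decrease f g \<beta> x a"
  unfolding sufficient_decrease_def
proof
  fix j
  let ?d = "newton_direction f g x" and ?t = "newton_value f g x"
  have "(1 - a) *\<^sub>R x + a *\<^sub>R (x + ?d) = x + a *\<^sub>R ?d"
    by (simp add: algebra_simps)
  then have gj: "g j (x + a *\<^sub>R ?d) \<le> (1 - a) * g j x + a * g j (x + ?d)"
    using convex_onD[OF assms(3), of a x "x + ?d"] assms(7,8) by simp
  have fj: "f j (x + a *\<^sub>R ?d)
      \<le> f j x + a * (gradient (f j) x \<bullet> ?d) + L / 2 * a\<^sup>2 * (norm ?d)\<^sup>2"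
    using assms by (intro lipschitz_gradient_descent_inequality) auto
  have "a / 2 * ((L * a) * (norm ?d)\<^sup>2) \<le> a / 2 * (?d \<bullet> (hessian (f j) x *v ?d))"
    using assms(7) mult_right_mono[OF assms(9), of "(norm ?d)\<^sup>2"] assms(4)[of ?d j]
    by (intro mult_left_mono) auto
  then have hj: "L / 2 * a\<^sup>2 * (norm ?d)\<^sup>2 \<le> a / 2 * (?d \<bullet> (hessian (f j) x *v ?d))"
    by (simp add: power2_eq_square algebra_simps)
  have "a * newton_model_component (f j) (g j) x ?d \<le> a * ?t"
    using newton_model_component_le[of f j g x ?d] assms(7)
    by (simp add: newton_value_def)
  also have "\<dots> \<le> \<beta> * a * ?t"
    using mult_right_mono_neg[of "\<beta> * a" a ?t] assms(5,6,7) by simp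
  finally have "a * newton_model_component (f j) (g j) x ?d \<le> \<beta> * a * ?t" .
  then show "objective f g (x + a *\<^sub>R ?d) $ j \<le> objective f g x $ j + \<beta> * a * ?t"
    using fj gj hj by (simp add: objective_def newton_model_component_def algebra_simps)
qed

text \<open>
  If backtracking went past the initial step \<open>1\<close>, then the step before the accepted one was
  rejected and hence longer than \<open>c\<close>.
\<close>

lemma step_size_acceptance:
  assumes "\<And>a. 0 < a \<Longrightarrow> a \<le> 1 \<Longrightarrow> a \<le> c \<Longrightarrow> sufficient_decrease f g \<beta> x a"
    and "0 < c" "0 < r" "r < 1"
  shows "sufficient_decrease f g \<beta> x (step_size f g r \<beta> x)"
    and "min 1 (r * c) \<le> step_size f g r \<beta> x"
proof -
  let ?P = "\<lambda>i. sufficient_decrease f g \<beta> x (r ^ i)"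
  obtain i where "r ^ i < c"
    using real_arch_pow_inv[of c r] assms by auto
  then have "?P i"
    using assms by (intro assms(1)) (auto intro: power_le_one)
  then show "sufficient_decrease f g \<beta> x (step_size f g r \<beta> x)"
    unfolding step_size_def by (rule LeastI)
  show "min 1 (r * c) \<le> step_size f g r \<beta> x"
  proof (cases "LEAST i. ?P i")
    case 0
    then show ?thesis by (simp add: step_size_def)
  next
    case (Suc n)
    then have "\<not> ?P n"
      using not_less_Least[of n ?P] by simp
    then have "c < r ^ n"
      using assms(1)[of "r ^ n"] assms(3,4) by (force intro: power_le_one)
    then have "r * c \<le> step_size f g r \<beta> x"
      using Suc assms(3) by (simp add: step_size_def)
    then show ?thesis by simp
  qed
qed

section \<open>Criticality from the model\<close>

text \<open>
  Dividing the model at \<open>a *\<^sub>R d\<close> by \<open>a\<close> turns the quadratic term into one of order \<open>a\<close>, so each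
  component converges to the directional derivative of the corresponding objective, and the finite
  maximum follows.
\<close>

lemma critical_point_if_newton_model_nonneg:
  fixes f g :: "'m::finite \<Rightarrow> real^'n \<Rightarrow> real"
  assumes "\<And>j. (f j) differentiable (at x)" "\<And>j. convex_on UNIV (g j)"
    and "\<And>d. 0 \<le> newton_model f g x d"
  shows "critical_point (objective f g) x"
  unfolding critical_point_def
proof
  fix d
  have "\<exists>l. ((\<lambda>a. (g j (x + a *\<^sub>R d) - g j x) / a) \<longlongrightarrow> l) (at_right 0)" for j
    by (rule convex_difference_quotient_tendsto[OF assms(2)]) (rule exI)
  then have "\<exists>g'. \<forall>j. ((\<lambda>a. (g j (x + a *\<^sub>R d) - g j x) / a) \<longlongrightarrow> g' j) (at_right 0)"
    by (intro choice allI)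
  then obtain g' where
    "\<forall>j. ((\<lambda>a. (g j (x + a *\<^sub>R d) - g j x) / a) \<longlongrightarrow> g' j) (at_right 0)" ..
  note g' = this[rule_format]
  have dir: "dir_deriv (\<lambda>y. objective f g y $ j) x d = gradient (f j) x \<bullet> d + g' j" for j
  proof -
    have "((\<lambda>a. (f j (x + a *\<^sub>R d) - f j x) / a + (g j (x + a *\<^sub>R d) - g j x) / a)
        \<longlongrightarrow> gradient (f j) x \<bullet> d + g' j) (at_right 0)"
      by (intro tendsto_add difference_quotient_tendsto_gradient assms g')
    then have "((\<lambda>a. (objective f g (x + a *\<^sub>R d) $ j - objective f g x $ j) / a)
        \<longlongrightarrow> gradient (f j) x \<bullet> d + g' j) (at_right 0)"
      by (simp add: objective_def add_diff_add add_divide_distrib)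
    then show ?thesis
      unfolding dir_deriv_def by (intro tendsto_Lim trivial_limit_at_right_real)
  qed
  define p where "p j a = gradient (f j) x \<bullet> d + a / 2 * (d \<bullet> (hessian (f j) x *v d))
      + (g j (x + a *\<^sub>R d) - g j x) / a" for j a
  have "(p j \<longlongrightarrow> gradient (f j) x \<bullet> d + 0 / 2 * (d \<bullet> (hessian (f j) x *v d)) + g' j) (at_right 0)" for j
    unfolding p_def[abs_def] by (intro tendsto_intros g') auto
  then have lim: "((\<lambda>a. MAX j. p j a) \<longlongrightarrow> (MAX j. gradient (f j) x \<bullet> d + g' j)) (at_right 0)"
    by (intro tendsto_Max_image) auto
  have "0 \<le> (MAX j. p j a)" if "0 < a" for a
  proof -
    have p: "newton_model_component (f j) (g j) x (a *\<^sub>R d) = a * p j a" for j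
      using that by (simp add: newton_model_component_def p_def matrix_vector_mult_scaleR distrib_left)
    have "newton_model f g x (a *\<^sub>R d) \<in> range (\<lambda>j. newton_model_component (f j) (g j) x (a *\<^sub>R d))"
      unfolding newton_model_def by (rule Max_in) auto
    then obtain j where "newton_model f g x (a *\<^sub>R d) = a * p j a"
      by (auto simp: p)
    then have "0 \<le> p j a"
      using assms(3)[of "a *\<^sub>R d"] that by (simp add: zero_le_mult_iff)
    also have "\<dots> \<le> (MAX j. p j a)"
      by (rule Max_ge) auto
    finally show ?thesis .
  qed
  then have "\<forall>\<^sub>F a in at_right 0. 0 \<le> (MAX j. p j a)"
    by (intro eventually_at_rightI[of 0 1]) simp_all
  then show "0 \<le> (MAX j. dir_deriv (\<lambda>y. objective f g y $ j) x d)"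
    unfolding dir using lim by (intro tendsto_lowerbound[OF _ _ trivial_limit_at_right_real])
qed

section \<open>Accumulation points of the method\<close>

theorem theorem6:
  fixes f g :: "'m::finite \<Rightarrow> real^'n \<Rightarrow> real"
    and \<sigma> L r \<beta> :: real
    and x0 xstar :: "real^'n"
    and s :: "nat \<Rightarrow> nat"
  assumes "\<sigma> > 0" and "L > 0"
    and "\<And>j. twice_continuously_differentiable (f j)"
    and "\<And>j. strongly_convex \<sigma> (f j)"
    and "\<And>j. L-lipschitz_on UNIV (gradient (f j))"
    and "\<And>j. convex_on UNIV (g j)"
    and "\<And>j. continuous_on UNIV (g j)"
    and "r \<in> {0<..<1}" and "\<beta> \<in> {0<..<1}"
    and "bounded {x. objective f g x \<le> objective f g x0}"
    and "strict_mono s"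
    and "(newton_prox_grad f g r \<beta> x0 \<circ> s) \<longlonglongrightarrow> xstar"
  shows "critical_point (objective f g) xstar"
proof -
  let ?X = "newton_prox_grad f g r \<beta> x0"
  define amin where "amin = min 1 (r * (\<sigma> / L))"
  have "0 < amin" using assms(1,2,8) by (simp add: amin_def)
  have diff: "(f j) differentiable (at y)" and hess: "\<sigma> * (norm d)\<^sup>2 \<le> d \<bullet> (hessian (f j) y *v d)"
    for j y d
    using assms(3)[of j] strongly_convex_hessian_lower_bound[OF assms(4)[of j], of y d]
    by (auto simp: twice_continuously_differentiable_def)
  have t_le: "newton_value f g x \<le> newton_model f g x d" for x d
    by (rule newton_value_le_newton_model[OF assms(6,7) hess assms(1)])
  have t_nonpos: "newton_value f g x \<le> 0" for x
    using t_le[of x 0] by simp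
  have small: "sufficient_decrease f g \<beta> x a" if "0 < a" "a \<le> 1" "a \<le> \<sigma> / L" for x a
    using that assms(2,9) t_nonpos
    by (intro sufficient_decrease_small_step[OF diff assms(5,6) hess]) (auto simp: field_simps)
  have decrease: "objective f g (?X (Suc k)) $ j
      \<le> objective f g (?X k) $ j + \<beta> * amin * newton_value f g (?X k)" for k j
  proof -
    have step: "amin \<le> step_size f g r \<beta> (?X k)"
      unfolding amin_def using small assms(1,2,8) by (intro step_size_acceptance(2)) auto
    have "sufficient_decrease f g \<beta> (?X k) (step_size f g r \<beta> (?X k))"
      using small assms(1,2,8) by (intro step_size_acceptance(1)[where c = "\<sigma> / L"]) auto
    then have "objective f g (?X (Suc k)) $ j
        \<le> objective f g (?X k) $ j + \<beta> * step_size f g r \<beta> (?X k) * newton_value f g (?X k)"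
      by (simp add: sufficient_decrease_def Let_def)
    also have "\<beta> * step_size f g r \<beta> (?X k) * newton_value f g (?X k)
        \<le> \<beta> * amin * newton_value f g (?X k)"
      using step assms(9) t_nonpos by (intro mult_right_mono_neg mult_left_mono) auto
    finally show ?thesis by simp
  qed
  have antimono: "objective f g (?X l) $ j \<le> objective f g (?X k) $ j" if "k \<le> l" for k l j
  proof (rule lift_Suc_antimono_le[OF _ that])
    fix n
    have "\<beta> * amin * newton_value f g (?X n) \<le> 0"
      using assms(9) \<open>0 < amin\<close> t_nonpos by (intro mult_nonneg_nonpos) auto
    then show "objective f g (?X (Suc n)) $ j \<le> objective f g (?X n) $ j"
      using decrease[of n j] by linarith
  qed
  \<comment> \<open>The bound on the model values does not depend on the objective, so any one of them will do.\<close>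
  fix j :: 'm
  define \<Phi> where "\<Phi> k = objective f g (?X (s k)) $ j" for k
  have "isCont (f j) xstar" "isCont (g j) xstar"
    using diff assms(7)[of j]
    by (auto simp: continuous_on_eq_continuous_at differentiable_imp_continuous_within)
  then have \<Phi>: "\<Phi> \<longlonglongrightarrow> f j xstar + g j xstar"
    using tendsto_add[OF isCont_tendsto_compose isCont_tendsto_compose, OF _ assms(12) _ assms(12)]
    by (simp add: \<Phi>_def[abs_def] objective_def comp_def)
  have value_bound: "(\<Phi> (Suc k) - \<Phi> k) / (\<beta> * amin) \<le> newton_value f g (?X (s k))" for k
  proof -
    \<comment> \<open>By strict monotonicity, \<open>s (Suc k)\<close> is at least one iteration after \<open>s k\<close>.\<close>
    have "\<Phi> (Suc k) \<le> objective f g (?X (Suc (s k))) $ j"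
      unfolding \<Phi>_def using assms(11) by (intro antimono) (simp add: Suc_leI strict_mono_less)
    also have "\<dots> \<le> \<Phi> k + \<beta> * amin * newton_value f g (?X (s k))"
      unfolding \<Phi>_def by (rule decrease)
    finally show ?thesis
      using assms(9) \<open>0 < amin\<close> by (simp add: divide_le_eq algebra_simps)
  qed
  have "(\<lambda>k. (\<Phi> (Suc k) - \<Phi> k) / (\<beta> * amin)) \<longlonglongrightarrow>
      ((f j xstar + g j xstar) - (f j xstar + g j xstar)) / (\<beta> * amin)"
    using assms(9) \<open>0 < amin\<close> by (intro tendsto_intros LIMSEQ_Suc \<Phi>) auto
  then have gap: "(\<lambda>k. (\<Phi> (Suc k) - \<Phi> k) / (\<beta> * amin)) \<longlonglongrightarrow> 0"
    by simp
  have "0 \<le> newton_model f g xstar d" for d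
  proof (rule LIMSEQ_le[OF gap])
    show "(\<lambda>k. newton_model f g (?X (s k)) d) \<longlonglongrightarrow> newton_model f g xstar d"
      using tendsto_newton_model_in_point[OF assms(3,7,12), where d = d] by (simp add: comp_def)
    show "\<exists>N. \<forall>k\<ge>N. (\<Phi> (Suc k) - \<Phi> k) / (\<beta> * amin) \<le> newton_model f g (?X (s k)) d"
      using order_trans[OF value_bound t_le] by (intro exI allI impI)
  qed
  then show ?thesis
    using diff assms(6) by (intro critical_point_if_newton_model_nonneg) auto
qed

end
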